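(* Let $\kappa_1,\kappa_2,\kappa_3,\kappa_4\in\mathbb{C}$ and put $k=\kappa_1-\kappa_2-\kappa_4$. Each of the following three non-abelian Painlevé-6 systems has an isomonodromic Lax representation $$\mathbf{A}_z-\mathbf{B}_\lambda=[\mathbf{B},\mathbf{A}],\qquad \mathbf{A}=\frac{A_0}{\lambda}+\frac{A_1}{\lambda-1}+\frac{A_2}{\lambda-z},\qquad\mathbf{B}=B_0-\frac{A_2}{\lambda-z},\qquad A_0=\begin{pmatrix}-1-\kappa_1+\kappa_4 & u z^{-1}-1 \\ 0 & 0\end{pmatrix},$$ that is, with the indicated $A_1,A_2,B_0$, this matrix identity (in $\lambda$) is equivalent to the system. (i) System $$\begin{aligned} z(z-1)u'&=2uvu^2-2uvu-\kappa_1u^2+\kappa_2u+z(-uvu-vu^2+uv+vu+\kappa_4u+k), \\ z(z-1)v'&=-vu^2v-2vuvu+2vuv+\tfrac12(\kappa_1+\kappa_3)uv+\tfrac12(3\kappa_1-\kappa_3)vu-\kappa_2v+\tfrac14(\kappa_3^2-\kappa_1^2)+z(vuv+v^2u-v^2-\kappa_4v),\end{aligned}$$ with $$A_1=\begin{pmatrix} -uv+\kappa_1 & 1 \\ -vu^2v+\frac12(\kappa_1+\kappa_3)uv+\frac12(\kappa_1-\kappa_3)vu+\frac14(\kappa_3^2-\kappa_1^2) & vu\end{pmatrix},\quad A_2=\begin{pmatrix} uv+k & -u z^{-1} \\ z\, v u v+k\, z\, v & -vu\end{pmatrix},$$ $$B_0=\begin{pmatrix}\frac{1}{z(z-1)}\big(2uvu-\kappa_1u-z(uv+vu+k)\big)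 & 0 \\ -vuv-kv & 0\end{pmatrix}.$$ (ii) System $$\begin{aligned} z(z-1)u'&=uvu^2+vu^3-uvu-vu^2-\kappa_1u^2+\kappa_2u+z(-uvu-vu^2+uv+vu+\kappa_4u+k), \\ z(z-1)v'&=-2vuvu-v^2u^2+vuv+v^2u+2\kappa_1vu-\kappa_2v+\kappa_3+z(vuv+v^2u-v^2-\kappa_4v),\end{aligned}$$ with $$A_1=\begin{pmatrix} -vu+\kappa_1 & 1 \\ -vuvu+\kappa_1vu+\kappa_3 & vu\end{pmatrix},\quad A_2=\begin{pmatrix} vu+k & -u z^{-1} \\ z\, v^2 u+k\, z\, v & -vu\end{pmatrix},$$ $$B_0=\begin{pmatrix}\frac{1}{z(z-1)}\big(uvu+vu^2-\kappa_1u-z(vu+v+k)\big) & 0 \\ -v^2u-kv & \frac{1}{z-1}(vu-v)\end{pmatrix}.$$ (iii) System $$\begin{aligned} z(z-1)u'&=u^2vu+uvu^2-u^2v-uvu-\kappa_1u^2+\kappa_2u+z(-uvu-vu^2+uv+vu+\kappa_4u+k), \\ z(z-1)v'&=-uvuv-vu^2v-vuvu+uv^2+vuv+\kappa_1uv+\kappa_1vu-\kappa_2v+\kappa_3+z(vuv+v^2u-v^2-\kappa_4v),\end{aligned}$$ with $$A_1=\begin{pmatrix} -uv+\kappa_1 & 1 \\ -uvuv+\kappa_1uv+\kappa_3 & uv\end{pmatrix},\quad A_2=\begin{pmatrix} uv+k & -u z^{-1} \\ z\, u v^2+k\, z\, v & -uv\end{pmatrix},$$ $$B_0=\begin{pmatrix}\frac{1}{z(z-1)}\big(u^2v+uvu-\kappa_1u-z(2uv+vu-v+k)\big)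 & 0 \\ -uv^2-kv & \frac{1}{z-1}(-vu+v)\end{pmatrix}.$$
   Context: Let $\mathcal{F}=\mathbb{C}(z)\langle u,v\rangle$ be the free unital associative algebra on $u,v$ over $\mathbb{C}(z)$ ($z$ central). A non-autonomous system prescribing $u'$ and $v'$ is a $\mathbb{C}$-linear derivation $'$ of $\mathcal{F}$ with $z'=1$ and the given values of $u',v'$. The spectral parameter $\lambda$ is a central indeterminate with $\lambda'=0$; $\mathbf{A},\mathbf{B}$ are $2\times2$ matrices whose entries are rational in $\lambda$ with coefficients in $\mathcal{F}$; $\mathbf{A}_z$ is obtained by applying the derivation $'$ to every entry, $\mathbf{B}_\lambda$ is the entrywise derivative in $\lambda$ (with $u,v,z$ independent of $\lambda$), and $[\mathbf{B},\mathbf{A}]=\mathbf{B}\mathbf{A}-\mathbf{A}\mathbf{B}$. "The identity is equivalent to the system" means: for a derivation $'$ of $\mathcal{F}$ with $z'=1$, the identity holds for all $\lambda$ if and only if $u'$ and $v'$ are given by the system. *)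

theory Defs
  imports
    "HOL-Library.Poly_Mapping"
    "HOL-Computational_Algebra.Polynomial_Factorial"
    "HOL-Analysis.Cartesian_Space"
begin

datatype letter = U | V

datatype word = Word (letters: "letter list")

instantiation word :: monoid_add
begin

definition zero_word :: word where "0 = Word []"

definition plus_word :: "word \<Rightarrow> word \<Rightarrow> word"
  where "x + y = Word (letters x @ letters y)"

instance
  by standard (simp_all add: zero_word_def plus_word_def)

end

text \<open>
  The free unital associative algebra on two generators over a field is the monoid algebra of the
  free monoid of words; the product of \<^typ>\<open>word \<Rightarrow>\<^sub>0 'k\<close> is convolution, so coefficients are
  central and words multiply by concatenation.
\<close>

type_synonym 'k free_algebra = "word \<Rightarrow>\<^sub>0 'k"

definition scal :: "'k::field \<Rightarrow> 'k free_algebra"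
  where "scal c = Poly_Mapping.single 0 c"

definition gen :: "letter \<Rightarrow> 'k::field free_algebra"
  where "gen a = Poly_Mapping.single (Word [a]) 1"

text \<open>
  \<open>ratz\<close> is the field of rational functions of \<open>z\<close> over the complex numbers, and \<open>ratzl\<close> the field
  of rational functions of \<open>\<lambda>\<close> over \<open>ratz\<close>. Noncommutative polynomials that depend rationally on a
  central \<open>\<lambda>\<close> are elements of the free algebra over \<open>ratzl\<close>.
\<close>

type_synonym ratz = "complex poly fract"
type_synonym ratzl = "ratz poly fract"
type_synonym F = "ratz free_algebra"
type_synonym Fl = "ratzl free_algebra"

definition zvar :: ratz where "zvar = to_fract [:0, 1:]"

definition lvar :: ratzl where "lvar = to_fract [:0, 1:]"

definition ratz_to_ratzl :: "ratz \<Rightarrow> ratzl"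
  where "ratz_to_ratzl c = to_fract [:c:]"

definition F_to_Fl :: "F \<Rightarrow> Fl"
  where "F_to_Fl = Poly_Mapping.map ratz_to_ratzl"

definition const :: "complex \<Rightarrow> F"
  where "const c = scal (to_fract [:c:])"

abbreviation uF :: F  ("\<^bold>u") where "\<^bold>u \<equiv> gen U"
abbreviation vF :: F  ("\<^bold>v") where "\<^bold>v \<equiv> gen V"
abbreviation zF :: F  ("\<^bold>z") where "\<^bold>z \<equiv> scal zvar"

definition derivation :: "('a::ring \<Rightarrow> 'a) \<Rightarrow> bool"
  where "derivation D \<longleftrightarrow>
    (\<forall>x y. D (x + y) = D x + D y) \<and> (\<forall>x y. D (x * y) = D x * y + x * D y)"

definition F_derivation :: "(F \<Rightarrow> F) \<Rightarrow> bool"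
  where "F_derivation D \<longleftrightarrow>
    derivation D \<and> (\<forall>c x. D (const c * x) = const c * D x) \<and> D \<^bold>z = 1"

lemma derivation_add: "derivation D \<Longrightarrow> D (x + y) = D x + D y"
  and derivation_mult: "derivation D \<Longrightarrow> D (x * y) = D x * y + x * D y"
  by (simp_all add: derivation_def)

lemma derivation_0: "derivation D \<Longrightarrow> D 0 = 0"
  using derivation_add[of D 0 0] by simp

lemma derivation_1: "derivation (D :: 'a::ring_1 \<Rightarrow> 'a) \<Longrightarrow> D 1 = 0"
  using derivation_mult[of D 1 1] by simp

text \<open>
  Extension of a derivation of an integral domain to its fraction field by the quotient rule.
  The choice of the representing fraction is immaterial, see \<open>fract_deriv_Fract\<close>.
\<close>

definition fract_deriv :: "('a::idom \<Rightarrow> 'a) \<Rightarrow> 'a fract \<Rightarrow> 'a fract"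
  where "fract_deriv d q =
    (SOME r. \<exists>a b. b \<noteq> 0 \<and> q = Fract a b \<and> r = Fract (d a * b - a * d b) (b ^ 2))"

lemma fract_deriv_Fract:
  assumes d: "derivation d" and b: "b \<noteq> 0"
  shows "fract_deriv d (Fract a b) = Fract (d a * b - a * d b) (b ^ 2)"
  unfolding fract_deriv_def
proof (rule some_equality)
  show "\<exists>a' b'. b' \<noteq> 0 \<and> Fract a b = Fract a' b' \<and>
      Fract (d a * b - a * d b) (b ^ 2) = Fract (d a' * b' - a' * d b') (b' ^ 2)"
    using b by blast
next
  fix r
  assume "\<exists>a' b'. b' \<noteq> 0 \<and> Fract a b = Fract a' b' \<and> r = Fract (d a' * b' - a' * d b') (b' ^ 2)"
  then obtain a' b' where b': "b' \<noteq> 0" and eq: "Fract a b = Fract a' b'"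
    and r: "r = Fract (d a' * b' - a' * d b') (b' ^ 2)" by blast
  have ab: "a * b' = a' * b" using eq b b' by (simp add: eq_fract)
  have dab: "d a * b' + a * d b' = d a' * b + a' * d b"
    using arg_cong[OF ab, of d] by (simp add: derivation_mult[OF d])
  have "(d a' * b' - a' * d b') * b ^ 2 - (d a * b - a * d b) * b' ^ 2
      = - (b * b') * ((d a * b' + a * d b') - (d a' * b + a' * d b))
        + (a * b' - a' * b) * (d b * b' + b * d b')"
    by (simp add: algebra_simps power2_eq_square)
  then have "(d a' * b' - a' * d b') * b ^ 2 = (d a * b - a * d b) * b' ^ 2"
    by (simp add: ab dab)
  then show "r = Fract (d a * b - a * d b) (b ^ 2)"
    using b b' by (simp add: r eq_fract)
qed

lemma derivation_fract_deriv:
  assumes "derivation d"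
  shows "derivation (fract_deriv d)"
  unfolding derivation_def
proof (intro conjI allI)
  fix x y :: "'a fract"
  obtain a b where x: "x = Fract a b" "b \<noteq> 0" by (cases x)
  obtain a' b' where y: "y = Fract a' b'" "b' \<noteq> 0" by (cases y)
  show "fract_deriv d (x + y) = fract_deriv d x + fract_deriv d y"
    using x y assms
    by (simp add: fract_deriv_Fract derivation_add derivation_mult eq_fract
        algebra_simps power2_eq_square)
  show "fract_deriv d (x * y) = fract_deriv d x * y + x * fract_deriv d y"
    using x y assms
    by (simp add: fract_deriv_Fract derivation_mult eq_fract algebra_simps power2_eq_square)
qed

lemma derivation_pderiv: "derivation (pderiv :: 'a::idom poly \<Rightarrow> 'a poly)"
  by (simp add: derivation_def pderiv_add pderiv_mult algebra_simps)

lemma derivation_map_poly: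
  fixes d :: "'a::idom \<Rightarrow> 'a"
  assumes d: "derivation d"
  shows "derivation (map_poly d)"
  unfolding derivation_def
proof (intro conjI allI)
  fix p q :: "'a poly"
  note d0 = derivation_0[OF d]
  have ds: "d (sum f A) = (\<Sum>i\<in>A. d (f i))" for f :: "nat \<Rightarrow> 'a" and A
    by (induction A rule: infinite_finite_induct) (simp_all add: d0 derivation_add[OF d])
  show "map_poly d (p + q) = map_poly d p + map_poly d q"
    by (rule poly_eqI) (simp add: coeff_map_poly d0 derivation_add[OF d])
  show "map_poly d (p * q) = map_poly d p * q + p * map_poly d q"
    by (rule poly_eqI)
      (simp add: coeff_map_poly coeff_mult d0 ds derivation_mult[OF d] sum.distrib)
qed

definition ratz_dz :: "ratz \<Rightarrow> ratz" where "ratz_dz = fract_deriv pderiv"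

definition ratzl_dz :: "ratzl \<Rightarrow> ratzl" where "ratzl_dz = fract_deriv (map_poly ratz_dz)"

definition ratzl_dl :: "ratzl \<Rightarrow> ratzl" where "ratzl_dl = fract_deriv pderiv"

text \<open>The derivative in \<open>\<lambda>\<close>, with \<open>u\<close>, \<open>v\<close>, \<open>z\<close> independent of \<open>\<lambda>\<close>.\<close>

definition Fl_dl :: "Fl \<Rightarrow> Fl" where "Fl_dl = Poly_Mapping.map ratzl_dl"

text \<open>
  The extension of a derivation \<open>D\<close> of \<open>F\<close> with \<open>D z = 1\<close> to coefficients rational in \<open>\<lambda>\<close>, with
  \<open>\<lambda>' = 0\<close>: a term \<open>c(z,\<lambda>) w\<close> has derivative \<open>(\<partial>c/\<partial>z) w + c D w\<close>.
  Complex-linearity and \<open>D z = 1\<close> force \<open>D\<close> to be \<open>d/dz\<close> on rational functions of \<open>z\<close>, so this is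
  the unique derivation that extends \<open>D\<close> and annihilates \<open>\<lambda>\<close>; see \<open>prolong_F_to_Fl\<close>,
  \<open>prolong_lvar\<close>, \<open>derivation_prolong\<close>.
\<close>

definition prolong :: "(F \<Rightarrow> F) \<Rightarrow> Fl \<Rightarrow> Fl"
  where "prolong D x = (\<Sum>w\<in>Poly_Mapping.keys x.
    Poly_Mapping.single w (ratzl_dz (Poly_Mapping.lookup x w)) +
    scal (Poly_Mapping.lookup x w) * F_to_Fl (D (Poly_Mapping.single w 1)))"

lemma to_fract_inverse: "p \<noteq> 0 \<Longrightarrow> Fract a p = to_fract a * inverse (to_fract p)"
  by (simp add: to_fract_def)

lemma fract_deriv_to_fract:
  assumes "derivation d"
  shows "fract_deriv d (to_fract a) = to_fract (d a)"
  using fract_deriv_Fract[OF assms, of 1 a] derivation_1[OF assms] by (simp add: to_fract_def)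

lemma derivation_ratz_dz: "derivation ratz_dz"
  and derivation_ratzl_dz: "derivation ratzl_dz"
  and derivation_ratzl_dl: "derivation ratzl_dl"
  by (simp_all add: ratz_dz_def ratzl_dz_def ratzl_dl_def derivation_fract_deriv
      derivation_pderiv derivation_map_poly)

lemma ratzl_dz_lvar: "ratzl_dz lvar = 0"
  using derivation_0[OF derivation_ratz_dz] derivation_1[OF derivation_ratz_dz]
  by (simp add: ratzl_dz_def lvar_def fract_deriv_to_fract derivation_map_poly derivation_ratz_dz
      map_poly_pCons)

lemma ratzl_dz_ratz: "ratzl_dz (ratz_to_ratzl c) = ratz_to_ratzl (ratz_dz c)"
  using derivation_0[OF derivation_ratz_dz]
  by (simp add: ratzl_dz_def ratz_to_ratzl_def fract_deriv_to_fract derivation_map_poly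
      derivation_ratz_dz map_poly_pCons)

lemma ratz_to_ratzl_hom:
  "ratz_to_ratzl 0 = 0" "ratz_to_ratzl 1 = 1"
  "ratz_to_ratzl (a + b) = ratz_to_ratzl a + ratz_to_ratzl b"
  "ratz_to_ratzl (a * b) = ratz_to_ratzl a * ratz_to_ratzl b"
  by (simp_all add: ratz_to_ratzl_def flip: to_fract_add to_fract_mult one_pCons)

lemma free_algebra_induct [case_names single add]:
  fixes x :: "'k::field free_algebra"
  assumes s: "\<And>w c. P (Poly_Mapping.single w c)"
    and a: "\<And>x y. P x \<Longrightarrow> P y \<Longrightarrow> P (x + y)"
  shows "P x"
proof -
  have "P (sum (\<lambda>w. Poly_Mapping.single w (Poly_Mapping.lookup x w)) S)" if "finite S" for S
    using that by (induction S) (use s[of 0 0] in \<open>auto intro: s a\<close>)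
  moreover have "x = (\<Sum>w\<in>Poly_Mapping.keys x. Poly_Mapping.single w (Poly_Mapping.lookup x w))"
    by (rule poly_mapping_eqI) (simp add: lookup_sum lookup_single when_def in_keys_iff)
  ultimately show ?thesis by (metis finite_keys)
qed

lemma scal_single: "scal c * Poly_Mapping.single w a = Poly_Mapping.single w (c * a)"
  by (simp add: scal_def mult_single)

lemma scal_mult: "scal (a * b) = scal a * scal b"
  and scal_add: "scal (a + b) = scal a + scal b"
  and scal_1: "scal 1 = 1"
  and scal_0: "scal 0 = 0"
  by (simp_all add: scal_def mult_single single_add)

lemma scal_central: "scal c * x = x * scal c"
  by (induction x rule: free_algebra_induct)
    (simp_all add: scal_def mult_single mult.commute distrib_left distrib_right)

lemma F_to_Fl_single: "F_to_Fl (Poly_Mapping.single w c) = Poly_Mapping.single w (ratz_to_ratzl c)"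
  by (rule poly_mapping_eqI)
    (simp add: F_to_Fl_def map.rep_eq lookup_single when_def ratz_to_ratzl_hom)

lemma F_to_Fl_add: "F_to_Fl (x + y) = F_to_Fl x + F_to_Fl y"
proof (rule poly_mapping_eqI)
  have l: "Poly_Mapping.lookup (F_to_Fl x) w = ratz_to_ratzl (Poly_Mapping.lookup x w)" for x w
    by (simp add: F_to_Fl_def map.rep_eq when_def ratz_to_ratzl_hom)
  show "Poly_Mapping.lookup (F_to_Fl (x + y)) w = Poly_Mapping.lookup (F_to_Fl x + F_to_Fl y) w" for w
    by (simp add: l lookup_add ratz_to_ratzl_hom)
qed

lemma F_to_Fl_mult: "F_to_Fl (x * y) = F_to_Fl x * F_to_Fl y"
proof (induction x rule: free_algebra_induct)
  case (single w c)
  show ?case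
    by (induction y rule: free_algebra_induct)
      (simp_all add: mult_single F_to_Fl_single ratz_to_ratzl_hom F_to_Fl_add distrib_left)
qed (simp add: F_to_Fl_add distrib_right)

lemma F_derivation_scal:
  assumes D: "F_derivation D"
  shows "D (scal c) = scal (ratz_dz c)"
proof -
  have d: "derivation D" and lin: "\<And>c x. D (const c * x) = const c * D x" and z: "D \<^bold>z = 1"
    using D by (auto simp: F_derivation_def)
  have cst: "D (const a) = 0" for a
    using lin[of a 1] derivation_1[OF d] by simp
  have poly: "D (scal (to_fract p)) = scal (to_fract (pderiv p))" for p
  proof (induction p)
    case 0
    show ?case by (simp add: scal_0 derivation_0[OF d])
  next
    case (pCons a p)
    have "pCons a p = [:a:] + [:0, 1:] * p" by simp
    then have "to_fract (pCons a p) = to_fract [:a:] + zvar * to_fract p"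
      unfolding zvar_def by (simp only: to_fract_add to_fract_mult)
    then have "D (scal (to_fract (pCons a p))) = D (const a + \<^bold>z * scal (to_fract p))"
      by (simp only: const_def scal_add scal_mult)
    also have "\<dots> = scal (to_fract p) + \<^bold>z * scal (to_fract (pderiv p))"
      by (simp add: derivation_add[OF d] derivation_mult[OF d] cst z pCons.IH)
    also have "\<dots> = scal (to_fract (p + [:0, 1:] * pderiv p))"
      unfolding zvar_def by (simp only: to_fract_add to_fract_mult scal_add scal_mult)
    also have "p + [:0, 1:] * pderiv p = pderiv (pCons a p)"
      by (simp add: pderiv_pCons)
    finally show ?case .
  qed
  obtain p q where c: "c = Fract p q" and q: "q \<noteq> 0" by (cases c)
  have tq: "to_fract q \<noteq> 0" using q by simp
  have cq: "c * to_fract q = to_fract p"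
    using tq by (simp add: c to_fract_inverse q)
  have "D (scal c) * scal (to_fract q) + scal c * D (scal (to_fract q)) = D (scal (to_fract p))"
    by (simp add: cq flip: derivation_mult[OF d] scal_mult)
  moreover have "ratz_dz c * to_fract q + c * to_fract (pderiv q) = to_fract (pderiv p)"
    using derivation_mult[OF derivation_ratz_dz, of c "to_fract q"]
    by (simp add: cq ratz_dz_def fract_deriv_to_fract derivation_pderiv)
  then have "scal (ratz_dz c) * scal (to_fract q) + scal c * D (scal (to_fract q)) = D (scal (to_fract p))"
    by (simp add: poly flip: scal_mult scal_add)
  ultimately have "D (scal c) * scal (to_fract q) = scal (ratz_dz c) * scal (to_fract q)"
    by (metis add_right_cancel)
  then have "D (scal c) * scal (to_fract q) * scal (inverse (to_fract q))
      = scal (ratz_dz c) * scal (to_fract q) * scal (inverse (to_fract q))" by simp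
  then show ?thesis using tq by (simp add: mult.assoc scal_1 flip: scal_mult)
qed

lemma prolong_single:
  assumes "derivation D"
  shows "prolong D (Poly_Mapping.single w c) =
    Poly_Mapping.single w (ratzl_dz c) + scal c * F_to_Fl (D (Poly_Mapping.single w 1))"
  by (cases "c = 0") (simp_all add: prolong_def scal_0 derivation_0[OF derivation_ratzl_dz])

lemma prolong_add: "prolong D (x + y) = prolong D x + prolong D y"
proof -
  let ?T = "\<lambda>x w. Poly_Mapping.single w (ratzl_dz (Poly_Mapping.lookup x w)) +
    scal (Poly_Mapping.lookup x w) * F_to_Fl (D (Poly_Mapping.single w 1))"
  let ?S = "Poly_Mapping.keys x \<union> Poly_Mapping.keys y"
  have e: "prolong D x = sum (?T x) S" if "finite S" "Poly_Mapping.keys x \<subseteq> S" for x S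
    unfolding prolong_def using that
    by (intro sum.mono_neutral_left)
      (auto simp: in_keys_iff scal_0 derivation_0[OF derivation_ratzl_dz])
  have "?T (x + y) w = ?T x w + ?T y w" for w
    by (simp add: lookup_add derivation_add[OF derivation_ratzl_dz] single_add scal_add distrib_right)
  then have "sum (?T (x + y)) ?S = sum (?T x) ?S + sum (?T y) ?S"
    by (simp flip: sum.distrib)
  then show ?thesis
    using e[of ?S x] e[of ?S y] e[of ?S "x + y"] Poly_Mapping.keys_add[of x y] by auto
qed

lemma prolong_F_to_Fl:
  assumes D: "F_derivation D"
  shows "prolong D (F_to_Fl x) = F_to_Fl (D x)"
proof -
  have d: "derivation D" using D by (simp add: F_derivation_def)
  show ?thesis
  proof (induction x rule: free_algebra_induct)
    case (single w c)
    have "D (Poly_Mapping.single w c) = D (scal c * Poly_Mapping.single w 1)"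
      by (simp add: scal_single)
    also have "\<dots> = Poly_Mapping.single w (ratz_dz c) + scal c * D (Poly_Mapping.single w 1)"
      unfolding derivation_mult[OF d] F_derivation_scal[OF D] by (simp add: scal_single)
    finally show ?case
      by (simp add: F_to_Fl_single prolong_single[OF d] F_to_Fl_add F_to_Fl_mult ratzl_dz_ratz)
        (simp add: scal_def F_to_Fl_single)
  qed (simp add: F_to_Fl_add prolong_add derivation_add[OF d])
qed

lemma prolong_lvar:
  assumes "derivation D"
  shows "prolong D (scal lvar) = 0"
proof -
  have "F_to_Fl (D (Poly_Mapping.single 0 1)) = 0"
    using derivation_1[OF assms] F_to_Fl_single[of 0 0] by (simp add: ratz_to_ratzl_hom)
  then show ?thesis
    by (simp add: scal_def prolong_single[OF assms] ratzl_dz_lvar)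
qed

lemma derivation_prolong:
  assumes D: "F_derivation D"
  shows "derivation (prolong D)"
proof -
  have d: "derivation D" using D by (simp add: F_derivation_def)
  have s: "prolong D (Poly_Mapping.single w a * Poly_Mapping.single w' b) =
      prolong D (Poly_Mapping.single w a) * Poly_Mapping.single w' b +
      Poly_Mapping.single w a * prolong D (Poly_Mapping.single w' b)" for w w' a b
  proof -
    let ?m = "\<lambda>w. Poly_Mapping.single w 1 :: F" and ?M = "\<lambda>w. Poly_Mapping.single w 1 :: Fl"
    have M: "Poly_Mapping.single w a = scal a * ?M w" for w a by (simp add: scal_single)
    have "?m (w + w') = ?m w * ?m w'" by (simp add: mult_single)
    then have 1: "F_to_Fl (D (?m (w + w'))) =
        F_to_Fl (D (?m w)) * ?M w' + ?M w * F_to_Fl (D (?m w'))"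
      by (simp add: derivation_mult[OF d] F_to_Fl_add F_to_Fl_mult F_to_Fl_single ratz_to_ratzl_hom)
    have c: "?M w * (scal c * y) = scal c * (?M w * y)"
      "F_to_Fl x * (scal c * y) = scal c * (F_to_Fl x * y)" for w x y c
      by (metis mult.assoc scal_central)+
    have 2: "?M (w + w') = ?M w * ?M w'" by (simp add: mult_single)
    have 3: "prolong D (Poly_Mapping.single w a) = scal (ratzl_dz a) * ?M w + scal a * F_to_Fl (D (?m w))"
      for w a by (simp add: prolong_single[OF d] scal_single)
    have 4: "Poly_Mapping.single w a * Poly_Mapping.single w' b = Poly_Mapping.single (w + w') (a * b)"
      by (simp add: mult_single)
    have 5: "scal b * (scal a * x) = scal a * (scal b * x)" for a b and x :: Fl
      unfolding mult.assoc[symmetric] scal_mult[symmetric] by (simp only: mult.commute)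
    show ?thesis
      unfolding 4 unfolding 3
      unfolding 1 2 derivation_mult[OF derivation_ratzl_dz] M[of w a] M[of w' b]
      by (simp only: scal_add scal_mult distrib_left distrib_right mult.assoc c 5 add_ac)
  qed
  have "prolong D (x * y) = prolong D x * y + x * prolong D y" for x y
  proof (induction x rule: free_algebra_induct)
    case (single w c)
    show ?case
      by (induction y rule: free_algebra_induct)
        (simp_all add: s prolong_add distrib_left)
  qed (simp add: prolong_add distrib_right)
  then show ?thesis by (simp add: derivation_def prolong_add)
qed

definition mat2 :: "'a::zero \<Rightarrow> 'a \<Rightarrow> 'a \<Rightarrow> 'a \<Rightarrow> 'a^2^2"
  where "mat2 a b c d = vector [vector [a, b], vector [c, d]]"

definition map_mat :: "('a \<Rightarrow> 'b) \<Rightarrow> 'a^2^2 \<Rightarrow> 'b^2^2"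
  where "map_mat f M = (\<chi> i j. f (M $ i $ j))"

text \<open>\<open>term_mat c M\<close> is the product of the rational function \<open>c(z,\<lambda>)\<close> and the matrix \<open>M\<close> over \<open>F\<close>.\<close>

definition term_mat :: "ratzl \<Rightarrow> F^2^2 \<Rightarrow> Fl^2^2"
  where "term_mat c M = map_mat (\<lambda>x. scal c * F_to_Fl x) M"

definition lax_A :: "F^2^2 \<Rightarrow> F^2^2 \<Rightarrow> F^2^2 \<Rightarrow> Fl^2^2"
  where "lax_A A0 A1 A2 =
    term_mat (1 / lvar) A0 + term_mat (1 / (lvar - 1)) A1 +
    term_mat (1 / (lvar - ratz_to_ratzl zvar)) A2"

definition lax_B :: "F^2^2 \<Rightarrow> F^2^2 \<Rightarrow> Fl^2^2"
  where "lax_B B0 A2 = term_mat 1 B0 - term_mat (1 / (lvar - ratz_to_ratzl zvar)) A2"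

definition lax_equation :: "(F \<Rightarrow> F) \<Rightarrow> Fl^2^2 \<Rightarrow> Fl^2^2 \<Rightarrow> bool"
  where "lax_equation D A B \<longleftrightarrow>
    map_mat (prolong D) A - map_mat Fl_dl B = B ** A - A ** B"

end

theory Submission
  imports Defs
begin

text \<open>
  The double poles at \<open>\<lambda> = z\<close> cancel in \<open>A\<^sub>z - B\<^sub>\<lambda>\<close>, and partial fractions turn both sides into
  combinations of \<open>1/\<lambda>\<close>, \<open>1/(\<lambda>-1)\<close>, \<open>1/(\<lambda>-z)\<close>, which are linearly independent over \<open>F\<close>. Hence
  the Lax equation says that the residues satisfy
  \<open>A0' = [B0,A0] + [A2,A0]/z\<close>, \<open>A1' = [B0,A1] + [A2,A1]/(z-1)\<close>,
  \<open>A2' = [B0,A2] - [A2,A0]/z - [A2,A1]/(z-1)\<close>.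
  These twelve entries follow from the system by direct computation in the free algebra. Conversely,
  the (1,2) entry of the first equation is the equation for \<open>u'\<close>; the (2,2) entry of the second
  then gives the equation for \<open>v'\<close> multiplied by \<open>u\<close> on one side, and \<open>u\<close> is not a zero divisor.
\<close>

section \<open>Derivations, and the \<lambda>-derivative of terms\<close>

lemma derivation_diff: "derivation d \<Longrightarrow> d (x - y) = d x - d y"
  using derivation_add[of d "x - y" y] by simp

lemma derivation_minus: "derivation d \<Longrightarrow> d (- x) = - d x"
  using derivation_diff[of d 0 x] derivation_0[of d] by simp

lemma map_mat_add:
  "(\<And>x y. f (x + y) = f x + f y) \<Longrightarrow> map_mat f (M + N) = map_mat f M + map_mat f N"
  by (simp add: map_mat_def vec_eq_iff)

lemma prolong_scal:
  assumes "derivation D"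
  shows "prolong D (scal c) = scal (ratzl_dz c)"
  using F_to_Fl_single[of 0 0] derivation_1[OF assms]
  by (simp add: scal_def prolong_single[OF assms] ratz_to_ratzl_hom)

lemma ratzl_dl_ratz: "ratzl_dl (ratz_to_ratzl a) = 0"
  by (simp add: ratzl_dl_def ratz_to_ratzl_def fract_deriv_to_fract derivation_pderiv pderiv_pCons)

lemma lookup_Fl_dl: "Poly_Mapping.lookup (Fl_dl x) w = ratzl_dl (Poly_Mapping.lookup x w)"
  by (simp add: Fl_dl_def map.rep_eq when_def derivation_0[OF derivation_ratzl_dl])

lemma Fl_dl_add: "Fl_dl (x + y) = Fl_dl x + Fl_dl y"
  by (rule poly_mapping_eqI)
    (simp add: lookup_Fl_dl lookup_add derivation_add[OF derivation_ratzl_dl])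

text \<open>Elements coming from \<open>F\<close> are constant in \<lambda>, so the product rule on
  each coefficient leaves only the derivative of \<open>c\<close>.\<close>

lemma Fl_dl_term: "Fl_dl (scal c * F_to_Fl x) = scal (ratzl_dl c) * F_to_Fl x"
proof -
  note d = derivation_ratzl_dl
  have single: "Fl_dl (Poly_Mapping.single w b) = Poly_Mapping.single w (ratzl_dl b)" for w b
    by (rule poly_mapping_eqI) (simp add: lookup_Fl_dl lookup_single when_def derivation_0[OF d])
  show ?thesis
    by (induction x rule: free_algebra_induct)
      (simp_all add: F_to_Fl_single scal_single single derivation_mult[OF d] ratzl_dl_ratz
        F_to_Fl_add Fl_dl_add distrib_left)
qed

section \<open>Independence of the simple poles at \<open>0\<close>, \<open>1\<close> and
  \<open>a\<close>\<close>

lemma lvar_neq_ratz: "lvar \<noteq> ratz_to_ratzl a"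
  by (simp add: lvar_def ratz_to_ratzl_def)

text \<open>Clearing denominators leaves a polynomial in \<lambda> that vanishes identically. At
  each pole two of its three summands vanish, and the third is a nonzero multiple of the residue
  there.\<close>

lemma pole_expansion_unique:
  assumes a: "a \<noteq> 0" "a \<noteq> 1"
    and eq: "1 / lvar * ratz_to_ratzl p + 1 / (lvar - 1) * ratz_to_ratzl q
        + 1 / (lvar - ratz_to_ratzl a) * ratz_to_ratzl r = 0"
  shows "p = 0 \<and> q = 0 \<and> r = 0"
proof -
  have nz: "lvar \<noteq> 0" "lvar - 1 \<noteq> 0" "lvar - ratz_to_ratzl a \<noteq> 0"
    using lvar_neq_ratz[of 0] lvar_neq_ratz[of 1] lvar_neq_ratz[of a] by (simp_all add: ratz_to_ratzl_hom)
  let ?P = "[:-1, 1:] * [:-a, 1:] * [:p:] + [:0, 1:] * [:-a, 1:] * [:q:] + [:0, 1:] * [:-1, 1:] * [:r:]"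
  have l: "lvar - 1 = to_fract [:-1, 1:]" "lvar - ratz_to_ratzl a = to_fract [:-a, 1:]"
    by (simp_all add: lvar_def ratz_to_ratzl_def one_pCons flip: to_fract_1 to_fract_diff)
  \<comment> \<open>Stated for arbitrary nonzero elements, so that \<open>field_simps\<close> treats
    each denominator as an atom.\<close>
  have clear_denominators: "m * n * p + l * n * q + l * m * r =
      l * m * n * (1 / l * p + 1 / m * q + 1 / n * r)"
    if "l \<noteq> 0" "m \<noteq> 0" "n \<noteq> 0" for l m n p q r :: ratzl
    using that by (simp add: field_simps)
  have "(lvar - 1) * (lvar - ratz_to_ratzl a) * ratz_to_ratzl p
      + lvar * (lvar - ratz_to_ratzl a) * ratz_to_ratzl q + lvar * (lvar - 1) * ratz_to_ratzl r = 0"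
    unfolding clear_denominators[OF nz] eq by simp
  then have "to_fract ?P = 0"
    unfolding l by (simp only: lvar_def ratz_to_ratzl_def to_fract_mult to_fract_add)
  then have P: "?P = 0" by (simp only: to_fract_eq_0_iff)
  have "poly ?P 0 = 0" "poly ?P 1 = 0" "poly ?P a = 0"
    unfolding P by simp_all
  then show ?thesis using a by simp
qed

section \<open>Matrices over \<open>F\<close> with coefficients rational in \<lambda>\<close>

lemma matrix_diff_ldistrib: "(A :: 'a::ring_1^'n^'m) ** (B - C) = A ** B - A ** C"
  and matrix_diff_rdistrib: "((A' :: 'a::ring_1^'n^'m) - B') ** C' = A' ** C' - B' ** C'"
  by (simp_all add: vec_eq_iff matrix_matrix_mult_def right_diff_distrib left_diff_distrib
      sum_subtractf)

lemma matrix_add_rdistrib: "(A + B) ** C = A ** C + B ** C"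
  by (simp add: vec_eq_iff matrix_matrix_mult_def distrib_right sum.distrib)

lemma term_mat_coeff_add: "term_mat (c + d) M = term_mat c M + term_mat d M"
  by (simp add: term_mat_def map_mat_def vec_eq_iff scal_add distrib_right)

lemma term_mat_add: "term_mat c (M + N) = term_mat c M + term_mat c N"
  by (simp add: term_mat_def map_mat_def vec_eq_iff F_to_Fl_add distrib_left)

lemma term_mat_diff: "term_mat c (M - N) = term_mat c M - term_mat c N"
  using term_mat_add[of c "M - N" N] by simp

lemma term_mat_coeff_0: "term_mat 0 M = 0"
  by (simp add: term_mat_def map_mat_def vec_eq_iff scal_0)

lemma term_mat_coeff_diff: "term_mat (c - d) M = term_mat c M - term_mat d M"
  using term_mat_coeff_add[of "c - d" d M] by simp

text \<open>A coefficient free of \<lambda> can be absorbed into the matrix over \<open>F\<close>;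
  this is how the factors \<open>1 / z\<close> and \<open>1 / (z - 1)\<close> from partial fractions
  enter the residues.\<close>

lemma term_mat_ratz_mult:
  "term_mat (ratz_to_ratzl a * c) M = term_mat c (map_mat ((*) (scal a)) M)"
proof -
  have "scal (ratz_to_ratzl a * c) * F_to_Fl x = scal c * F_to_Fl (scal a * x)" for x
    by (simp add: F_to_Fl_mult mult.commute[of "ratz_to_ratzl a"] scal_mult mult.assoc)
      (simp add: scal_def F_to_Fl_single)
  then show ?thesis by (simp add: term_mat_def map_mat_def vec_eq_iff)
qed

text \<open>Scalars are central, so both coefficients can be collected in front of each product of
  entries.\<close>

lemma term_mat_mult: "term_mat c M ** term_mat d N = term_mat (c * d) (M ** N)"
proof -
  have "scal c * x * (scal d * y) = scal (c * d) * (x * y)" for x y :: Fl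
    using scal_central[of d x] by (simp only: scal_mult mult.assoc) (simp only: flip: mult.assoc)
  then show ?thesis
    by (simp add: term_mat_def map_mat_def matrix_matrix_mult_def vec_eq_iff sum_2 F_to_Fl_add
        F_to_Fl_mult distrib_left)
qed

lemma prolong_term_mat:
  assumes D: "F_derivation D"
  shows "map_mat (prolong D) (term_mat c M) = term_mat (ratzl_dz c) M + term_mat c (map_mat D M)"
proof -
  have d: "derivation D" using D by (simp add: F_derivation_def)
  show ?thesis
    by (simp add: term_mat_def map_mat_def vec_eq_iff derivation_mult[OF derivation_prolong[OF D]]
        prolong_scal[OF d] prolong_F_to_Fl[OF D])
qed

lemma Fl_dl_term_mat: "map_mat Fl_dl (term_mat c M) = term_mat (ratzl_dl c) M"
  by (simp add: term_mat_def map_mat_def Fl_dl_term)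

section \<open>Derivatives of reciprocals and of the two variables\<close>

lemma derivation_inverse:
  fixes d :: "'a::field \<Rightarrow> 'a"
  assumes d: "derivation d" and x: "x \<noteq> 0"
  shows "d (1 / x) = - d x * (1 / x)^2"
proof -
  have "d (x * (1 / x)) = 0" using x by (simp add: derivation_1[OF d])
  then have "d x * (1 / x) + x * d (1 / x) = 0" unfolding derivation_mult[OF d] .
  then have "x * d (1 / x) = - d x * (1 / x)" by (simp add: eq_neg_iff_add_eq_0 add.commute)
  then show ?thesis using x by (simp add: field_simps power2_eq_square)
qed

lemma ratz_dz_zvar: "ratz_dz zvar = 1"
  by (simp add: ratz_dz_def zvar_def fract_deriv_to_fract derivation_pderiv pderiv_pCons
      flip: one_pCons)

lemma ratzl_dl_lvar: "ratzl_dl lvar = 1"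
  by (simp add: ratzl_dl_def lvar_def fract_deriv_to_fract derivation_pderiv pderiv_pCons
      flip: one_pCons)

lemma zvar_neq: "zvar \<noteq> 0" "zvar \<noteq> 1"
  unfolding zvar_def to_fract_0[symmetric] to_fract_1[symmetric] to_fract_eq_iff
  by (simp_all add: one_pCons)

section \<open>Two-by-two matrices by entries\<close>

lemma map_mat_mat2: "map_mat f (mat2 a b c d) = mat2 (f a) (f b) (f c) (f d)"
  by (simp add: map_mat_def mat2_def vec_eq_iff forall_2)

lemma mat2_mult:
  "mat2 a b c d ** mat2 a' b' c' d' =
    mat2 (a * a' + b * c') (a * b' + b * d') (c * a' + d * c') (c * b' + d * d')"
  by (simp add: mat2_def matrix_matrix_mult_def vec_eq_iff forall_2 sum_2)

lemma mat2_add: "mat2 a b c d + mat2 a' b' c' d' = mat2 (a + a') (b + b') (c + c') (d + d')"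
  and mat2_diff: "mat2 a b c d - mat2 a' b' c' d' = mat2 (a - a') (b - b') (c - c') (d - d')"
  for a b c d :: "'a::ring_1"
  by (simp_all add: mat2_def vec_eq_iff forall_2)

lemma mat2_eq_iff: "mat2 a b c d = mat2 a' b' c' d' \<longleftrightarrow> a = a' \<and> b = b' \<and> c = c' \<and> d = d'"
  by (auto simp add: mat2_def vec_eq_iff forall_2)

section \<open>The Lax equation as a system for the residues\<close>

text \<open>\<open>x\<close> and \<open>y\<close> stand for \<open>1 / z\<close> and
  \<open>1 / (z - 1)\<close>. An arbitrary ring is allowed so that the long computations can run
  with opaque central symbols instead of scalars of the free algebra.\<close>

definition residue_system ::
    "('a::ring_1 \<Rightarrow> 'a) \<Rightarrow> 'a \<Rightarrow> 'a \<Rightarrow> 'a^2^2 \<Rightarrow> 'a^2^2 \<Rightarrow> 'a^2^2 \<Rightarrow> 'a^2^2 \<Rightarrow> bool"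
  where "residue_system D x y A0 A1 A2 B0 \<longleftrightarrow>
    map_mat D A0 = B0 ** A0 - A0 ** B0 + map_mat ((*) x) (A2 ** A0 - A0 ** A2) \<and>
    map_mat D A1 = B0 ** A1 - A1 ** B0 + map_mat ((*) y) (A2 ** A1 - A1 ** A2) \<and>
    map_mat D A2 = B0 ** A2 - A2 ** B0
      - map_mat ((*) x) (A2 ** A0 - A0 ** A2) - map_mat ((*) y) (A2 ** A1 - A1 ** A2)"

lemma lookup_term_mat:
  "Poly_Mapping.lookup (term_mat c M $ i $ j) w =
    c * ratz_to_ratzl (Poly_Mapping.lookup (M $ i $ j) w)"
proof -
  have "Poly_Mapping.lookup (scal c * F_to_Fl x) w = c * ratz_to_ratzl (Poly_Mapping.lookup x w)"
    for x
    by (induction x rule: free_algebra_induct)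
      (simp_all add: F_to_Fl_single scal_single lookup_single when_def ratz_to_ratzl_hom F_to_Fl_add
        distrib_left lookup_add)
  then show ?thesis by (simp add: term_mat_def map_mat_def)
qed

text \<open>The words form a basis, so each matrix entry splits into one scalar pole expansion per
  word.\<close>

lemma term_mat_poles_independent:
  assumes "a \<noteq> 0" "a \<noteq> 1"
    and "term_mat (1 / lvar) M + term_mat (1 / (lvar - 1)) N
      + term_mat (1 / (lvar - ratz_to_ratzl a)) R = 0"
  shows "M = 0 \<and> N = 0 \<and> R = 0"
proof -
  have "Poly_Mapping.lookup (M $ i $ j) w = 0 \<and> Poly_Mapping.lookup (N $ i $ j) w = 0
      \<and> Poly_Mapping.lookup (R $ i $ j) w = 0" for i j w
  proof (rule pole_expansion_unique[OF assms(1,2)])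
    have "Poly_Mapping.lookup ((term_mat (1 / lvar) M + term_mat (1 / (lvar - 1)) N
      + term_mat (1 / (lvar - ratz_to_ratzl a)) R) $ i $ j) w = 0"
      unfolding assms(3) by simp
    then show "1 / lvar * ratz_to_ratzl (Poly_Mapping.lookup (M $ i $ j) w)
        + 1 / (lvar - 1) * ratz_to_ratzl (Poly_Mapping.lookup (N $ i $ j) w)
        + 1 / (lvar - ratz_to_ratzl a) * ratz_to_ratzl (Poly_Mapping.lookup (R $ i $ j) w) = 0"
      by (simp only: vector_add_component lookup_add lookup_term_mat)
  qed
  then show ?thesis by (simp add: vec_eq_iff poly_mapping_eq_iff fun_eq_iff)
qed

lemma lax_equation_iff_residue_system:
  assumes D: "F_derivation D"
  shows "lax_equation D (lax_A A0 A1 A2) (lax_B B0 A2) \<longleftrightarrow>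
    residue_system D (scal (1 / zvar)) (scal (1 / (zvar - 1))) A0 A1 A2 B0"
proof -
  define p0 where "p0 = 1 / lvar"
  define p1 where "p1 = 1 / (lvar - 1)"
  define p2 where "p2 = 1 / (lvar - ratz_to_ratzl zvar)"
  define C0 where "C0 = A2 ** A0 - A0 ** A2"
  define C1 where "C1 = A2 ** A1 - A1 ** A2"
  define X0 where "X0 = B0 ** A0 - A0 ** B0 + map_mat ((*) (scal (1 / zvar))) C0"
  define X1 where "X1 = B0 ** A1 - A1 ** B0 + map_mat ((*) (scal (1 / (zvar - 1)))) C1"
  define X2 where "X2 = B0 ** A2 - A2 ** B0 - map_mat ((*) (scal (1 / zvar))) C0
    - map_mat ((*) (scal (1 / (zvar - 1)))) C1"
  have nz: "lvar \<noteq> 0" "lvar - 1 \<noteq> 0" "lvar - ratz_to_ratzl zvar \<noteq> 0"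
    using lvar_neq_ratz[of 0] lvar_neq_ratz[of 1] lvar_neq_ratz[of zvar]
    by (simp_all add: ratz_to_ratzl_hom)
  note dz = derivation_ratzl_dz and dl = derivation_ratzl_dl
  have dz0: "ratzl_dz p0 = 0" and dz1: "ratzl_dz p1 = 0" and dz2: "ratzl_dz p2 = p2^2"
    using nz by (simp_all add: p0_def p1_def p2_def derivation_inverse[OF dz] derivation_diff[OF dz]
        derivation_1[OF dz] ratzl_dz_lvar ratzl_dz_ratz ratz_dz_zvar ratz_to_ratzl_hom)
  \<comment> \<open>\<open>p2\<close> depends on \<lambda> - z alone, so this is the negative of its
    z-derivative. With the sign of \<open>A2\<close> in \<open>lax_B\<close> the double poles on the
    left-hand side cancel.\<close>
  have dl2: "ratzl_dl p2 = - (p2^2)"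
    using nz by (simp add: p2_def derivation_inverse[OF dl] derivation_diff[OF dl] ratzl_dl_lvar
        ratzl_dl_ratz)
  \<comment> \<open>The partial fraction constants are formed before the embedding into functions of
    \<lambda>; their images are still inverse to z and z - 1.\<close>
  have h: "ratz_to_ratzl (1 / zvar) * ratz_to_ratzl zvar = 1"
      "ratz_to_ratzl (1 / (zvar - 1)) * (ratz_to_ratzl zvar - 1) = 1"
  proof -
    have "ratz_to_ratzl (1 / (zvar - 1)) * (ratz_to_ratzl zvar - 1)
        = ratz_to_ratzl (1 / (zvar - 1)) * ratz_to_ratzl (zvar - 1)"
      using ratz_to_ratzl_hom(3)[of "zvar - 1" 1] by (simp add: ratz_to_ratzl_hom)
    also have "\<dots> = 1" using zvar_neq by (simp flip: ratz_to_ratzl_hom)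
    finally show "ratz_to_ratzl (1 / (zvar - 1)) * (ratz_to_ratzl zvar - 1) = 1" .
  qed (use zvar_neq in \<open>simp flip: ratz_to_ratzl_hom\<close>)
  \<comment> \<open>Partial fractions for \<open>1 / ((\<lambda> - z) * (\<lambda> - s))\<close>,
    with \<open>c\<close> the inverse of z - s; applied at \<open>s = 0\<close> and
    \<open>s = 1\<close>.\<close>
  have pf: "c * (p2 - 1 / (lvar - s)) = p2 * (1 / (lvar - s))"
    if "c * (ratz_to_ratzl zvar - s) = 1" "lvar - s \<noteq> 0" for c s
  proof -
    have "p2 - 1 / (lvar - s) = (ratz_to_ratzl zvar - s) * (p2 * (1 / (lvar - s)))"
      using that(2) nz unfolding p2_def by (simp add: field_simps)
    then show ?thesis using that(1) by (metis mult.assoc mult_1_left)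
  qed
  have p20: "p2 * p0 = ratz_to_ratzl (1 / zvar) * (p2 - p0)"
    using pf[of "ratz_to_ratzl (1 / zvar)" 0] h nz by (simp add: p0_def)
  have p21: "p2 * p1 = ratz_to_ratzl (1 / (zvar - 1)) * (p2 - p1)"
    using pf[of "ratz_to_ratzl (1 / (zvar - 1))" 1] h nz by (simp add: p1_def)
  have add: "map_mat (prolong D) (M + N) = map_mat (prolong D) M + map_mat (prolong D) N" for M N
    by (rule map_mat_add) (rule prolong_add)
  have dlB: "map_mat Fl_dl (lax_B B0 A2) = term_mat (p2^2) A2"
  proof -
    have "lax_B B0 A2 = term_mat 1 B0 + term_mat (- p2) A2"
      using term_mat_coeff_diff[of 0 p2 A2] by (simp add: lax_B_def p2_def term_mat_coeff_0)
    moreover have "map_mat Fl_dl (M + N) = map_mat Fl_dl M + map_mat Fl_dl N" for M N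
      by (rule map_mat_add) (rule Fl_dl_add)
    ultimately show ?thesis
      by (simp add: Fl_dl_term_mat derivation_1[OF dl] derivation_minus[OF dl] term_mat_coeff_0 dl2)
  qed
  have lhs: "map_mat (prolong D) (lax_A A0 A1 A2) - map_mat Fl_dl (lax_B B0 A2)
      = term_mat p0 (map_mat D A0) + term_mat p1 (map_mat D A1) + term_mat p2 (map_mat D A2)"
    unfolding dlB lax_A_def p0_def[symmetric] p1_def[symmetric] p2_def[symmetric]
    by (simp add: add prolong_term_mat[OF D] dz0 dz1 dz2 term_mat_coeff_0)
  \<comment> \<open>The terms with \<open>p2 * p2\<close> carry the commutator of \<open>A2\<close>
    with itself and drop out.\<close>
  have "lax_B B0 A2 ** lax_A A0 A1 A2 - lax_A A0 A1 A2 ** lax_B B0 A2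
      = term_mat p0 (B0 ** A0 - A0 ** B0) + term_mat p1 (B0 ** A1 - A1 ** B0)
        + term_mat p2 (B0 ** A2 - A2 ** B0) - term_mat (p2 * p0) C0 - term_mat (p2 * p1) C1"
    unfolding lax_A_def lax_B_def p0_def[symmetric] p1_def[symmetric] p2_def[symmetric]
      C0_def C1_def
    by (simp add: matrix_add_ldistrib matrix_add_rdistrib matrix_diff_ldistrib matrix_diff_rdistrib
        term_mat_mult term_mat_diff mult.commute[of p0 p2] mult.commute[of p1 p2])
  also have "\<dots> = term_mat p0 X0 + term_mat p1 X1 + term_mat p2 X2"
    unfolding p20 p21 X0_def X1_def X2_def
    by (simp add: term_mat_ratz_mult term_mat_coeff_diff term_mat_add term_mat_diff)
  finally have rhs: "lax_B B0 A2 ** lax_A A0 A1 A2 - lax_A A0 A1 A2 ** lax_B B0 A2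
      = term_mat p0 X0 + term_mat p1 X1 + term_mat p2 X2" .
  have "lax_equation D (lax_A A0 A1 A2) (lax_B B0 A2) \<longleftrightarrow>
      term_mat p0 (map_mat D A0 - X0) + term_mat p1 (map_mat D A1 - X1)
        + term_mat p2 (map_mat D A2 - X2) = 0"
    unfolding lax_equation_def lhs rhs by (simp add: term_mat_diff algebra_simps)
  also have "\<dots> \<longleftrightarrow> map_mat D A0 - X0 = 0 \<and> map_mat D A1 - X1 = 0 \<and> map_mat D A2 - X2 = 0"
  proof
    show "map_mat D A0 - X0 = 0 \<and> map_mat D A1 - X1 = 0 \<and> map_mat D A2 - X2 = 0"
      if "term_mat p0 (map_mat D A0 - X0) + term_mat p1 (map_mat D A1 - X1)
        + term_mat p2 (map_mat D A2 - X2) = 0"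
      by (rule term_mat_poles_independent[OF zvar_neq that[unfolded p0_def p1_def p2_def]])
  next
    have "term_mat c 0 = 0" for c using term_mat_diff[of c 0 0] by simp
    then show "term_mat p0 (map_mat D A0 - X0) + term_mat p1 (map_mat D A1 - X1)
        + term_mat p2 (map_mat D A2 - X2) = 0"
      if "map_mat D A0 - X0 = 0 \<and> map_mat D A1 - X1 = 0 \<and> map_mat D A2 - X2 = 0"
      using that by (simp only:) simp
  qed
  also have "\<dots> \<longleftrightarrow> residue_system D (scal (1 / zvar)) (scal (1 / (zvar - 1))) A0 A1 A2 B0"
    unfolding residue_system_def X0_def X1_def X2_def C0_def C1_def by simp
  finally show ?thesis .
qed

section \<open>Normal forms in a ring with central parameters\<close>

definition central :: "'a::ring_1 \<Rightarrow> bool" where "central c \<longleftrightarrow> (\<forall>w. w * c = c * w)"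

text \<open>
  Here \<open>x = 1/z\<close>, \<open>y = 1/(z-1)\<close>, \<open>a = \<kappa>1\<close>, \<open>b = \<kappa>4\<close>; \<open>c\<close> is \<open>(\<kappa>1+\<kappa>3)/2\<close> in system (i) and \<open>\<kappa>3\<close> in the
  other two. Ordered rewriting sorts central factors alphabetically, and the reductions of products of
  \<open>x\<close>, \<open>y\<close>, \<open>z\<close> need these to be adjacent: the names matter.
\<close>

locale lax_ring =
  fixes D :: "'a::ring_1 \<Rightarrow> 'a" and u v x y z a b c k :: 'a
  assumes D: "derivation D" and Dz: "D z = 1"
    and cst: "D a = 0" "D b = 0" "D c = 0" "D k = 0"
    and central: "central x" "central y" "central z" "central a" "central b" "central c" "central k"
    and xz: "x * z = 1" and yz: "y * z = y + 1"
    and cancel_left: "\<And>w. u * w = 0 \<Longrightarrow> w = 0"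
    and cancel_right: "\<And>w. w * u = 0 \<Longrightarrow> w = 0"
begin

text \<open>The first four rules carry central factors to the left of \<open>u\<close> and
  \<open>v\<close>; the last two are permutative and sort these factors among themselves. The
  premises prevent the rules from commuting \<open>u\<close> with \<open>v\<close>.\<close>

lemma central_move:
  "central r \<Longrightarrow> u * r = r * u" "central r \<Longrightarrow> u * (r * w) = r * (u * w)"
  "central r \<Longrightarrow> v * r = r * v" "central r \<Longrightarrow> v * (r * w) = r * (v * w)"
  "central r \<Longrightarrow> central s \<Longrightarrow> r * s = s * r"
  "central r \<Longrightarrow> central s \<Longrightarrow> r * (s * w) = s * (r * w)"
  unfolding central_def by (metis mult.assoc)+

text \<open>Partial fractions for \<open>1 / (z * (z - 1))\<close>: the product
  \<open>x * (y * z)\<close> is evaluated once by \<open>yz\<close> and once by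
  \<open>xz\<close>.\<close>

lemma xy: "x * y = y - x"
proof -
  have "x * (y * z) = x * y + x" by (simp only: yz distrib_left mult_1_right)
  moreover have "x * (y * z) = y"
    using central(1) xz by (metis central_def mult.assoc mult.right_neutral)
  ultimately show ?thesis by (simp add: eq_diff_eq)
qed

text \<open>In a right-nested product a reducible pair is followed by a tail \<open>w\<close>, so
  each reduction is needed in this form too. Together they expand mixed products of
  \<open>x\<close>, \<open>y\<close>, \<open>z\<close> into partial fractions.\<close>

lemma xyz_reduce:
  "x * (y * w) = y * w - x * w" "x * (z * w) = w" "y * (z * w) = y * w + w"
  by (simp_all add: xy xz yz distrib_right left_diff_distrib flip: mult.assoc)

lemma zx: "z * x = 1"
  using central(3) xz by (simp add: central_def)

text \<open>Differentiating \<open>z * x = 1\<close> gives \<open>x + z * D x = 0\<close>;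
  multiplication by \<open>x\<close> isolates \<open>D x\<close>.\<close>

lemma Dx: "D x = - (x * x)"
proof -
  have "D (z * x) = 0" by (simp only: zx derivation_1[OF D])
  then have "x + z * D x = 0" by (simp only: derivation_mult[OF D] Dz mult_1_left)
  then have "x * (x + z * D x) = 0" by (simp only: mult_zero_right)
  then have "x * x + D x = 0" by (simp only: distrib_left xyz_reduce)
  then show ?thesis by (simp add: eq_neg_iff_add_eq_0 add.commute)
qed

lemmas D_simps = derivation_add[OF D] derivation_mult[OF D] derivation_0[OF D] derivation_1[OF D]
  derivation_diff[OF D] derivation_minus[OF D] Dz Dx cst power2_eq_square power3_eq_cube

text \<open>The target is a sum of signed right-nested monomials with central factors in front and
  with powers and the numeral 2 written out. What then remains is reordering and cancelling
  summands, which \<open>add_ac\<close> settles.\<close>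

lemmas normalize = mult.assoc distrib_left distrib_right left_diff_distrib right_diff_distrib
  mult_minus_left mult_minus_right minus_minus mult_1_left mult_1_right
  mult_zero_left mult_zero_right diff_conv_add_uminus minus_add_distrib minus_zero
  add_0_left add_0_right mult_2 power2_eq_square power3_eq_cube
  central central_move xz yz xy xyz_reduce

text \<open>\<open>x * y\<close> is a two-sided inverse of \<open>z * (z - 1)\<close>. The solved
  form makes the system usable for substituting \<open>D u\<close> and \<open>D v\<close>.\<close>

lemma solve_derivative:
  "z * (z - 1) * w = r \<longleftrightarrow> w = x * y * r"
proof -
  have 1: "x * y * (z * (z - 1)) = 1" by (simp only: normalize) simp
  have 2: "z * (z - 1) * (x * y) = 1" by (simp only: normalize) simp
  have "x * y * (z * (z - 1) * w) = w" "z * (z - 1) * (x * y * r) = r"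
    using arg_cong[OF 1, of "\<lambda>t. t * w"] arg_cong[OF 2, of "\<lambda>t. t * r"]
    by (simp_all only: mult.assoc mult_1_left)
  then show ?thesis by auto
qed

section \<open>The residue equations of the three systems\<close>

lemma residue_system_i:
  assumes A0: "A0 = mat2 (- 1 - a + b) (u * x - 1) 0 0"
    and A1: "A1 = mat2 (- u * v + a) 1
      (- v * u^2 * v + c * u * v + (a - c) * v * u + c * (c - a)) (v * u)"
    and A2: "A2 = mat2 (u * v + k) (- u * x) (z * v * u * v + k * z * v) (- v * u)"
    and B0: "B0 = mat2 (x * y * (2 * u * v * u - a * u - z * (u * v + v * u + k))) 0
      (- v * u * v - k * v) 0"
  shows "residue_system D x y A0 A1 A2 B0 \<longleftrightarrow>
    z * (z - 1) * D u =
      2 * u * v * u^2 - 2 * u * v * u - a * u^2 + (a - b - k) * u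
      + z * (- u * v * u - v * u^2 + u * v + v * u + b * u + k) \<and>
    z * (z - 1) * D v =
      - v * u^2 * v - 2 * v * u * v * u + 2 * v * u * v + c * u * v + (2 * a - c) * v * u
      - (a - b - k) * v + c * (c - a)
      + z * (v * u * v + v^2 * u - v^2 - b * v)"
    (is "_ \<longleftrightarrow> _ = ?U \<and> _ = ?V")
proof -
  \<comment> \<open>\<open>f\<close> and \<open>g\<close> measure how far \<open>D u\<close> and
    \<open>D v\<close> are from the prescribed values; the entries used below then reduce to
    equations in \<open>f\<close> and \<open>g\<close> alone.\<close>
  define f g where "f = D u - x * y * ?U" and "g = D v - x * y * ?V"
  then have Du: "D u = x * y * ?U + f" and Dv: "D v = x * y * ?V + g" by simp_all
  have fg: "z * (z - 1) * D u = ?U \<longleftrightarrow> f = 0" "z * (z - 1) * D v = ?V \<longleftrightarrow> g = 0"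
    unfolding solve_derivative f_def g_def by simp_all
  \<comment> \<open>\<open>central_move\<close> moves scalars past \<open>u\<close> and
    \<open>v\<close> only, so \<open>f\<close> needs its own rule.\<close>
  have fx: "f * x = x * f" using central(1) by (simp add: central_def)
  note entries = residue_system_def A0 A1 A2 B0 map_mat_mat2 mat2_mult mat2_add mat2_diff mat2_eq_iff
  show ?thesis unfolding fg
  proof
    assume "residue_system D x y A0 A1 A2 B0"
    note eqs = this[unfolded entries]
    \<comment> \<open>This is the (1,2) entry of the equation for \<open>A0\<close>, where
      \<open>D (u * x)\<close> contributes the error term.\<close>
    have "x * f = 0"
      using eqs[THEN conjunct1, THEN conjunct2, THEN conjunct1]
      by (simp only: D_simps Du, simp only: normalize fx, simp add: add_ac)
    then have "z * (x * f) = 0" by simp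
    then have f: "f = 0" by (simp only: zx mult_1_left flip: mult.assoc)
    \<comment> \<open>This is the (2,2) entry of the equation for \<open>A1\<close>: with
      \<open>f = 0\<close>, the only error left in \<open>D (v * u)\<close> is
      \<open>g * u\<close>.\<close>
    have "g * u = 0"
      using eqs[THEN conjunct2, THEN conjunct1, THEN conjunct2, THEN conjunct2, THEN conjunct2]
      by (simp only: D_simps Du Dv f, simp only: normalize, simp add: add_ac)
    then show "f = 0 \<and> g = 0" using f cancel_right by blast
  next
    assume "f = 0 \<and> g = 0"
    then have Du': "D u = x * y * ?U" and Dv': "D v = x * y * ?V" using Du Dv by simp_all
    show "residue_system D x y A0 A1 A2 B0"
      unfolding entries
      \<comment> \<open>Each of the twelve entries becomes an identity between normal forms.\<close>
      by (intro conjI; simp only: D_simps Du' Dv'; simp only: normalize; simp add: add_ac)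
  qed
qed

text \<open>The lower right entry of \<open>A1\<close> is again \<open>v * u\<close>, so the error
  in \<open>D v\<close> appears as \<open>g * u\<close>, as in system (i).\<close>

lemma residue_system_ii:
  assumes A0: "A0 = mat2 (- 1 - a + b) (u * x - 1) 0 0"
    and A1: "A1 = mat2 (- v * u + a) 1 (- v * u * v * u + a * v * u + c) (v * u)"
    and A2: "A2 = mat2 (v * u + k) (- u * x) (z * v^2 * u + k * z * v) (- v * u)"
    and B0: "B0 = mat2 (x * y * (u * v * u + v * u^2 - a * u - z * (v * u + v + k))) 0
      (- (v^2 * u) - k * v) (y * (v * u - v))"
  shows "residue_system D x y A0 A1 A2 B0 \<longleftrightarrow>
    z * (z - 1) * D u =
      u * v * u^2 + v * u^3 - u * v * u - v * u^2 - a * u^2 + (a - b - k) * u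
      + z * (- u * v * u - v * u^2 + u * v + v * u + b * u + k) \<and>
    z * (z - 1) * D v =
      - 2 * v * u * v * u - v^2 * u^2 + v * u * v + v^2 * u
      + 2 * a * v * u - (a - b - k) * v + c
      + z * (v * u * v + v^2 * u - v^2 - b * v)"
    (is "_ \<longleftrightarrow> _ = ?U \<and> _ = ?V")
proof -
  define f g where "f = D u - x * y * ?U" and "g = D v - x * y * ?V"
  then have Du: "D u = x * y * ?U + f" and Dv: "D v = x * y * ?V + g" by simp_all
  have fg: "z * (z - 1) * D u = ?U \<longleftrightarrow> f = 0" "z * (z - 1) * D v = ?V \<longleftrightarrow> g = 0"
    unfolding solve_derivative f_def g_def by simp_all
  have fx: "f * x = x * f" using central(1) by (simp add: central_def)
  note entries = residue_system_def A0 A1 A2 B0 map_mat_mat2 mat2_mult mat2_add mat2_diff mat2_eq_iff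
  show ?thesis unfolding fg
  proof
    assume "residue_system D x y A0 A1 A2 B0"
    note eqs = this[unfolded entries]
    have "x * f = 0"
      using eqs[THEN conjunct1, THEN conjunct2, THEN conjunct1]
      by (simp only: D_simps Du, simp only: normalize fx, simp add: add_ac)
    then have "z * (x * f) = 0" by simp
    then have f: "f = 0" by (simp only: zx mult_1_left flip: mult.assoc)
    have "g * u = 0"
      using eqs[THEN conjunct2, THEN conjunct1, THEN conjunct2, THEN conjunct2, THEN conjunct2]
      by (simp only: D_simps Du Dv f, simp only: normalize, simp add: add_ac)
    then show "f = 0 \<and> g = 0" using f cancel_right by blast
  next
    assume "f = 0 \<and> g = 0"
    then have Du': "D u = x * y * ?U" and Dv': "D v = x * y * ?V" using Du Dv by simp_all
    show "residue_system D x y A0 A1 A2 B0"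
      unfolding entries
      by (intro conjI; simp only: D_simps Du' Dv'; simp only: normalize; simp add: add_ac)
  qed
qed

text \<open>The lower right entry of \<open>A1\<close> is now \<open>u * v\<close>, so the error in
  \<open>D v\<close> appears as \<open>u * g\<close>, and \<open>u\<close> is cancelled on the
  left.\<close>

lemma residue_system_iii:
  assumes A0: "A0 = mat2 (- 1 - a + b) (u * x - 1) 0 0"
    and A1: "A1 = mat2 (- u * v + a) 1 (- u * v * u * v + a * u * v + c) (u * v)"
    and A2: "A2 = mat2 (u * v + k) (- u * x) (z * u * v^2 + k * z * v) (- u * v)"
    and B0: "B0 = mat2 (x * y * (u^2 * v + u * v * u - a * u - z * (2 * u * v + v * u - v + k))) 0
      (- u * v^2 - k * v) (y * (- v * u + v))"
  shows "residue_system D x y A0 A1 A2 B0 \<longleftrightarrow>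
    z * (z - 1) * D u =
      u^2 * v * u + u * v * u^2 - u^2 * v - u * v * u - a * u^2 + (a - b - k) * u
      + z * (- u * v * u - v * u^2 + u * v + v * u + b * u + k) \<and>
    z * (z - 1) * D v =
      - u * v * u * v - v * u^2 * v - v * u * v * u + u * v^2 + v * u * v
      + a * u * v + a * v * u - (a - b - k) * v + c
      + z * (v * u * v + v^2 * u - v^2 - b * v)"
    (is "_ \<longleftrightarrow> _ = ?U \<and> _ = ?V")
proof -
  define f g where "f = D u - x * y * ?U" and "g = D v - x * y * ?V"
  then have Du: "D u = x * y * ?U + f" and Dv: "D v = x * y * ?V + g" by simp_all
  have fg: "z * (z - 1) * D u = ?U \<longleftrightarrow> f = 0" "z * (z - 1) * D v = ?V \<longleftrightarrow> g = 0"
    unfolding solve_derivative f_def g_def by simp_all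
  have fx: "f * x = x * f" using central(1) by (simp add: central_def)
  note entries = residue_system_def A0 A1 A2 B0 map_mat_mat2 mat2_mult mat2_add mat2_diff mat2_eq_iff
  show ?thesis unfolding fg
  proof
    assume "residue_system D x y A0 A1 A2 B0"
    note eqs = this[unfolded entries]
    have "x * f = 0"
      using eqs[THEN conjunct1, THEN conjunct2, THEN conjunct1]
      by (simp only: D_simps Du, simp only: normalize fx, simp add: add_ac)
    then have "z * (x * f) = 0" by simp
    then have f: "f = 0" by (simp only: zx mult_1_left flip: mult.assoc)
    have "u * g = 0"
      using eqs[THEN conjunct2, THEN conjunct1, THEN conjunct2, THEN conjunct2, THEN conjunct2]
      by (simp only: D_simps Du Dv f, simp only: normalize, simp add: add_ac)
    then show "f = 0 \<and> g = 0" using f cancel_left by blast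
  next
    assume "f = 0 \<and> g = 0"
    then have Du': "D u = x * y * ?U" and Dv': "D v = x * y * ?V" using Du Dv by simp_all
    show "residue_system D x y A0 A1 A2 B0"
      unfolding entries
      by (intro conjI; simp only: D_simps Du' Dv'; simp only: normalize; simp add: add_ac)
  qed
qed

end

section \<open>The free algebra as an instance of the abstract ring\<close>

text \<open>Adjoining a fixed letter to words is injective, so multiplication by a generator only
  shifts coefficients. This makes \<open>u\<close> cancellable on both sides.\<close>

lemma lookup_gen_mult: "Poly_Mapping.lookup (gen l * x) (Word [l] + w) = Poly_Mapping.lookup x w"
  and lookup_mult_gen: "Poly_Mapping.lookup (x * gen l) (w + Word [l]) = Poly_Mapping.lookup x w"
proof -
  have inj: "Word [l] + t = Word [l] + w \<longleftrightarrow> t = w" "t + Word [l] = w + Word [l] \<longleftrightarrow> t = w" for t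
    by (cases t; cases w; simp add: plus_word_def)+
  show "Poly_Mapping.lookup (gen l * x) (Word [l] + w) = Poly_Mapping.lookup x w"
    by (induction x rule: free_algebra_induct)
      (simp_all add: gen_def mult_single lookup_single when_def inj distrib_left lookup_add)
  show "Poly_Mapping.lookup (x * gen l) (w + Word [l]) = Poly_Mapping.lookup x w"
    by (induction x rule: free_algebra_induct)
      (simp_all add: gen_def mult_single lookup_single when_def inj distrib_right lookup_add)
qed

lemma gen_mult_eq_0: "gen l * x = 0 \<Longrightarrow> x = 0"
  by (rule poly_mapping_eqI) (metis lookup_gen_mult lookup_zero)

lemma mult_gen_eq_0: "x * gen l = 0 \<Longrightarrow> x = 0"
  by (rule poly_mapping_eqI) (metis lookup_mult_gen lookup_zero)

lemma central_scal: "central (scal c)"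
  unfolding central_def by (metis scal_central)

lemma const_add: "const (r + s) = const r + const s"
  and const_mult: "const (r * s) = const r * const s"
  and const_1: "const 1 = 1"
  by (simp_all add: const_def mult.commute scal_1 flip: scal_add scal_mult to_fract_add to_fract_mult one_pCons)

lemma const_diff: "const (r - s) = const r - const s"
  using const_add[of "r - s" s] by simp

lemma const_minus: "const (- r) = - const r"
  using const_diff[of 0 r] const_diff[of 0 0] by simp

lemma lax_ring_F:
  assumes D: "F_derivation D"
  shows "lax_ring D \<^bold>u (scal (1 / zvar)) (scal (1 / (zvar - 1))) \<^bold>z
    (const a) (const b) (const c) (const k)"
proof
  show "derivation D" "D \<^bold>z = 1" using D by (simp_all add: F_derivation_def)
  show "D (const a) = 0" "D (const b) = 0" "D (const c) = 0" "D (const k) = 0"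
    by (simp_all add: const_def F_derivation_scal[OF D] ratz_dz_def fract_deriv_to_fract
        derivation_pderiv scal_0 pderiv_pCons)
  show "scal (1 / zvar) * \<^bold>z = 1"
    using zvar_neq by (simp add: scal_1 flip: scal_mult)
  show "scal (1 / (zvar - 1)) * \<^bold>z = scal (1 / (zvar - 1)) + 1"
    unfolding scal_1[symmetric] scal_mult[symmetric] scal_add[symmetric]
    using zvar_neq by (simp add: field_simps)
qed (auto simp: central_scal const_def intro: gen_mult_eq_0 mult_gen_eq_0)

theorem mainTheorem8:
  fixes \<kappa>1 \<kappa>2 \<kappa>3 \<kappa>4 k :: complex and D :: "F \<Rightarrow> F" and A0 :: "F^2^2"
  assumes k: "k = \<kappa>1 - \<kappa>2 - \<kappa>4"
    and D: "F_derivation D"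
    and A0: "A0 = mat2 (const (- 1 - \<kappa>1 + \<kappa>4)) (\<^bold>u * scal (1 / zvar) - 1) 0 0"
  shows
    "(let A1 = mat2
            (- \<^bold>u * \<^bold>v + const \<kappa>1)
            1
            (- \<^bold>v * \<^bold>u^2 * \<^bold>v + const ((\<kappa>1 + \<kappa>3) / 2) * \<^bold>u * \<^bold>v + const ((\<kappa>1 - \<kappa>3) / 2) * \<^bold>v * \<^bold>u
               + const ((\<kappa>3^2 - \<kappa>1^2) / 4))
            (\<^bold>v * \<^bold>u);
          A2 = mat2
            (\<^bold>u * \<^bold>v + const k)
            (- \<^bold>u * scal (1 / zvar))
            (\<^bold>z * \<^bold>v * \<^bold>u * \<^bold>v + const k * \<^bold>z * \<^bold>v)
            (- \<^bold>v * \<^bold>u);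
          B0 = mat2
            (scal (1 / (zvar * (zvar - 1))) *
              (2 * \<^bold>u * \<^bold>v * \<^bold>u - const \<kappa>1 * \<^bold>u - \<^bold>z * (\<^bold>u * \<^bold>v + \<^bold>v * \<^bold>u + const k)))
            0
            (- \<^bold>v * \<^bold>u * \<^bold>v - const k * \<^bold>v)
            0
      in lax_equation D (lax_A A0 A1 A2) (lax_B B0 A2) \<longleftrightarrow>
        \<^bold>z * (\<^bold>z - 1) * D \<^bold>u =
            2 * \<^bold>u * \<^bold>v * \<^bold>u^2 - 2 * \<^bold>u * \<^bold>v * \<^bold>u - const \<kappa>1 * \<^bold>u^2 + const \<kappa>2 * \<^bold>u
            + \<^bold>z * (- \<^bold>u * \<^bold>v * \<^bold>u - \<^bold>v * \<^bold>u^2 + \<^bold>u * \<^bold>v + \<^bold>v * \<^bold>u + const \<kappa>4 * \<^bold>u + const k) \<and>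
        \<^bold>z * (\<^bold>z - 1) * D \<^bold>v =
            - \<^bold>v * \<^bold>u^2 * \<^bold>v - 2 * \<^bold>v * \<^bold>u * \<^bold>v * \<^bold>u + 2 * \<^bold>v * \<^bold>u * \<^bold>v
            + const ((\<kappa>1 + \<kappa>3) / 2) * \<^bold>u * \<^bold>v + const ((3 * \<kappa>1 - \<kappa>3) / 2) * \<^bold>v * \<^bold>u
            - const \<kappa>2 * \<^bold>v + const ((\<kappa>3^2 - \<kappa>1^2) / 4)
            + \<^bold>z * (\<^bold>v * \<^bold>u * \<^bold>v + \<^bold>v^2 * \<^bold>u - \<^bold>v^2 - const \<kappa>4 * \<^bold>v))
    \<and>
    (let A1 = mat2
            (- \<^bold>v * \<^bold>u + const \<kappa>1)
            1
            (- \<^bold>v * \<^bold>u * \<^bold>v * \<^bold>u + const \<kappa>1 * \<^bold>v * \<^bold>u + const \<kappa>3)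
            (\<^bold>v * \<^bold>u);
          A2 = mat2
            (\<^bold>v * \<^bold>u + const k)
            (- \<^bold>u * scal (1 / zvar))
            (\<^bold>z * \<^bold>v^2 * \<^bold>u + const k * \<^bold>z * \<^bold>v)
            (- \<^bold>v * \<^bold>u);
          B0 = mat2
            (scal (1 / (zvar * (zvar - 1))) *
              (\<^bold>u * \<^bold>v * \<^bold>u + \<^bold>v * \<^bold>u^2 - const \<kappa>1 * \<^bold>u - \<^bold>z * (\<^bold>v * \<^bold>u + \<^bold>v + const k)))
            0
            (- (\<^bold>v^2 * \<^bold>u) - const k * \<^bold>v)
            (scal (1 / (zvar - 1)) * (\<^bold>v * \<^bold>u - \<^bold>v))
      in lax_equation D (lax_A A0 A1 A2) (lax_B B0 A2) \<longleftrightarrow>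
        \<^bold>z * (\<^bold>z - 1) * D \<^bold>u =
            \<^bold>u * \<^bold>v * \<^bold>u^2 + \<^bold>v * \<^bold>u^3 - \<^bold>u * \<^bold>v * \<^bold>u - \<^bold>v * \<^bold>u^2 - const \<kappa>1 * \<^bold>u^2 + const \<kappa>2 * \<^bold>u
            + \<^bold>z * (- \<^bold>u * \<^bold>v * \<^bold>u - \<^bold>v * \<^bold>u^2 + \<^bold>u * \<^bold>v + \<^bold>v * \<^bold>u + const \<kappa>4 * \<^bold>u + const k) \<and>
        \<^bold>z * (\<^bold>z - 1) * D \<^bold>v =
            - 2 * \<^bold>v * \<^bold>u * \<^bold>v * \<^bold>u - \<^bold>v^2 * \<^bold>u^2 + \<^bold>v * \<^bold>u * \<^bold>v + \<^bold>v^2 * \<^bold>u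
            + 2 * const \<kappa>1 * \<^bold>v * \<^bold>u - const \<kappa>2 * \<^bold>v + const \<kappa>3
            + \<^bold>z * (\<^bold>v * \<^bold>u * \<^bold>v + \<^bold>v^2 * \<^bold>u - \<^bold>v^2 - const \<kappa>4 * \<^bold>v))
    \<and>
    (let A1 = mat2
            (- \<^bold>u * \<^bold>v + const \<kappa>1)
            1
            (- \<^bold>u * \<^bold>v * \<^bold>u * \<^bold>v + const \<kappa>1 * \<^bold>u * \<^bold>v + const \<kappa>3)
            (\<^bold>u * \<^bold>v);
          A2 = mat2
            (\<^bold>u * \<^bold>v + const k)
            (- \<^bold>u * scal (1 / zvar))
            (\<^bold>z * \<^bold>u * \<^bold>v^2 + const k * \<^bold>z * \<^bold>v)
            (- \<^bold>u * \<^bold>v);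
          B0 = mat2
            (scal (1 / (zvar * (zvar - 1))) *
              (\<^bold>u^2 * \<^bold>v + \<^bold>u * \<^bold>v * \<^bold>u - const \<kappa>1 * \<^bold>u
                - \<^bold>z * (2 * \<^bold>u * \<^bold>v + \<^bold>v * \<^bold>u - \<^bold>v + const k)))
            0
            (- \<^bold>u * \<^bold>v^2 - const k * \<^bold>v)
            (scal (1 / (zvar - 1)) * (- \<^bold>v * \<^bold>u + \<^bold>v))
      in lax_equation D (lax_A A0 A1 A2) (lax_B B0 A2) \<longleftrightarrow>
        \<^bold>z * (\<^bold>z - 1) * D \<^bold>u =
            \<^bold>u^2 * \<^bold>v * \<^bold>u + \<^bold>u * \<^bold>v * \<^bold>u^2 - \<^bold>u^2 * \<^bold>v - \<^bold>u * \<^bold>v * \<^bold>u - const \<kappa>1 * \<^bold>u^2 + const \<kappa>2 * \<^bold>u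
            + \<^bold>z * (- \<^bold>u * \<^bold>v * \<^bold>u - \<^bold>v * \<^bold>u^2 + \<^bold>u * \<^bold>v + \<^bold>v * \<^bold>u + const \<kappa>4 * \<^bold>u + const k) \<and>
        \<^bold>z * (\<^bold>z - 1) * D \<^bold>v =
            - \<^bold>u * \<^bold>v * \<^bold>u * \<^bold>v - \<^bold>v * \<^bold>u^2 * \<^bold>v - \<^bold>v * \<^bold>u * \<^bold>v * \<^bold>u + \<^bold>u * \<^bold>v^2 + \<^bold>v * \<^bold>u * \<^bold>v
            + const \<kappa>1 * \<^bold>u * \<^bold>v + const \<kappa>1 * \<^bold>v * \<^bold>u - const \<kappa>2 * \<^bold>v + const \<kappa>3
            + \<^bold>z * (\<^bold>v * \<^bold>u * \<^bold>v + \<^bold>v^2 * \<^bold>u - \<^bold>v^2 - const \<kappa>4 * \<^bold>v))"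
proof -
  \<comment> \<open>The scalars are expressed through the constants of the locale; \<kappa>2 is
    eliminated in favour of \<open>k\<close>.\<close>
  have cst: "const (- 1 - \<kappa>1 + \<kappa>4) = - 1 - const \<kappa>1 + const \<kappa>4"
    "const ((\<kappa>1 - \<kappa>3) / 2) = const \<kappa>1 - const ((\<kappa>1 + \<kappa>3) / 2)"
    "const ((3 * \<kappa>1 - \<kappa>3) / 2) = 2 * const \<kappa>1 - const ((\<kappa>1 + \<kappa>3) / 2)"
    "const ((\<kappa>3^2 - \<kappa>1^2) / 4) = const ((\<kappa>1 + \<kappa>3) / 2) * (const ((\<kappa>1 + \<kappa>3) / 2) - const \<kappa>1)"
    "const \<kappa>2 = const \<kappa>1 - const \<kappa>4 - const k"
    \<comment> \<open>Read from right to left, the homomorphism rules gather each side into a single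
      \<open>const\<close> and leave an identity of complex numbers.\<close>
    unfolding mult_2 const_add[symmetric] const_diff[symmetric] const_minus[symmetric]
      const_1[symmetric] const_mult[symmetric]
    by (rule arg_cong[of _ _ const], simp add: k field_simps power2_eq_square)+
  have xy: "scal (1 / (zvar * (zvar - 1))) = scal (1 / zvar) * scal (1 / (zvar - 1))"
    by (simp flip: scal_mult)
  \<comment> \<open>The third constant stays open: unification makes it
    \<open>(\<kappa>1 + \<kappa>3) / 2\<close> in system (i) and \<open>\<kappa>3\<close> in the
    other two.\<close>
  note R = lax_ring_F[OF D, of \<kappa>1 \<kappa>4 _ k]
  show ?thesis
    unfolding Let_def lax_equation_iff_residue_system[OF D] A0 cst xy
    by (intro conjI lax_ring.residue_system_i[OF R] lax_ring.residue_system_ii[OF R]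
        lax_ring.residue_system_iii[OF R] refl)
qed

end
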